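(* Let $A\in\mathbb{R}^{n\times n}$, $B\in\mathbb{R}^{n\times m}$ with $(A,B)$ stabilizable, let $Q\in\mathbb{R}^{n\times n}$ be symmetric positive semidefinite and $R\in\mathbb{R}^{m\times m}$ symmetric positive definite. Let $w_0,\dots,w_{T-1}$ ($T\ge1$) be drawn i.i.d. from a distribution $\mathcal{D}$ on $\mathbb{R}^n$ with zero mean and with $\|w_t\|_2\le\beta$ for all $t$, where $\beta>0$. Then for all $K\in\mathbb{R}^{m\times n}$ such that $A-BK$ is stable, writing $A-BK=MLM^{-1}$ with $\|L\|=1-\gamma$, $\gamma\in(0,1]$, the function $\mathrm{cost}_T(K;w)$ satisfies for every $\epsilon>0$ $$\Pr\left(\left|\mathrm{cost}_T(K;w)-\mathbb{E}_w[\mathrm{cost}_T(K;w)]\right|\ge\epsilon\right)\le2\exp\left(-\frac{2\epsilon^2\gamma^4T}{25\,\beta^4\,\kappa^4(M)\,\sigma_{\max}^2(Q+K^{\top}RK)}\right).$$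
   Context: $(A,B)$ is stabilizable if some $K'\in\mathbb{R}^{m\times n}$ makes $A-BK'$ stable. A square matrix is stable if its spectral radius is strictly less than $1$; a stable matrix $A-BK$ is similar to a contraction, i.e. there are an invertible matrix $M$ and a matrix $L$ with $A-BK=MLM^{-1}$ and $\|L\|=1-\gamma$ for some $\gamma\in(0,1]$, where $\|\cdot\|$ is the spectral (operator 2-) norm. $\kappa(M)=\|M\|\,\|M^{-1}\|$ is the condition number and $\sigma_{\max}$ the largest singular value. For $w=(w_0,\dots,w_{T-1})$, $$\mathrm{cost}_T(K;w)=\frac1T\sum_{t=0}^{T-1}x_t^{\top}(Q+K^{\top}RK)x_t,\qquad x_0=0,\quad x_{t+1}=(A-BK)x_t+w_t,$$ is the time-averaged cost of the linear policy $u_t=-Kx_t$ on the noise instance $w$. *)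

theory Defs
  imports "HOL-Probability.Probability"
begin

definition eigenvalues :: "'a::field ^ 'n ^ 'n \<Rightarrow> 'a set" where
  "eigenvalues A = {c. \<exists>v. v \<noteq> 0 \<and> A *v v = c *s v}"

text \<open>All complex eigenvalues count for the spectral radius of a real matrix. Their set is finite
  and nonempty, so the maximum exists.\<close>

definition spectral_radius :: "real ^ 'n ^ 'n \<Rightarrow> real" where
  "spectral_radius A = Max (cmod ` eigenvalues (map_matrix complex_of_real A))"

definition stable_matrix :: "real ^ 'n ^ 'n \<Rightarrow> bool" where
  "stable_matrix A \<longleftrightarrow> spectral_radius A < 1"

definition stabilizable :: "real ^ 'n ^ 'n \<Rightarrow> real ^ 'm ^ 'n \<Rightarrow> bool" where
  "stabilizable A B \<longleftrightarrow> (\<exists>K :: real ^ 'n ^ 'm. stable_matrix (A - B ** K))"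

definition sym_pos_semidef :: "real ^ 'n ^ 'n \<Rightarrow> bool" where
  "sym_pos_semidef Q \<longleftrightarrow> transpose Q = Q \<and> (\<forall>x. 0 \<le> x \<bullet> (Q *v x))"

definition sym_pos_def :: "real ^ 'n ^ 'n \<Rightarrow> bool" where
  "sym_pos_def R \<longleftrightarrow> transpose R = R \<and> (\<forall>x. x \<noteq> 0 \<longrightarrow> 0 < x \<bullet> (R *v x))"

text \<open>The norm that the type class instance puts on matrices is the Frobenius norm; the spectral norm
  is the operator norm of the induced map between Euclidean spaces.\<close>

definition spectral_norm :: "real ^ 'n ^ 'm \<Rightarrow> real" where
  "spectral_norm A = onorm (\<lambda>x. A *v x)"

definition cond_number :: "real ^ 'n ^ 'n \<Rightarrow> real" where
  "cond_number M = spectral_norm M * spectral_norm (matrix_inv M)"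

definition singular_values :: "real ^ 'n ^ 'm \<Rightarrow> real set" where
  "singular_values A = {s. 0 \<le> s \<and> s\<^sup>2 \<in> eigenvalues (transpose A ** A)}"

definition sigma_max :: "real ^ 'n ^ 'm \<Rightarrow> real" where
  "sigma_max A = Max (singular_values A)"

primrec state ::
  "real ^ 'n ^ 'n \<Rightarrow> real ^ 'm ^ 'n \<Rightarrow> real ^ 'n ^ 'm \<Rightarrow> (nat \<Rightarrow> real ^ 'n) \<Rightarrow> nat \<Rightarrow> real ^ 'n"
where
  "state A B K w 0 = 0"
| "state A B K w (Suc t) = (A - B ** K) *v state A B K w t + w t"

definition cost ::
  "real ^ 'n ^ 'n \<Rightarrow> real ^ 'm ^ 'n \<Rightarrow> real ^ 'n ^ 'n \<Rightarrow> real ^ 'm ^ 'm \<Rightarrow> nat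
     \<Rightarrow> real ^ 'n ^ 'm \<Rightarrow> (nat \<Rightarrow> real ^ 'n) \<Rightarrow> real"
where
  "cost A B Q R T K w =
     (1 / real T) *
       (\<Sum>t<T. state A B K w t \<bullet> ((Q + transpose K ** R ** K) *v state A B K w t))"

end

theory Submission
  imports Defs
begin

text \<open>
  The time-averaged cost is a function of \<open>T\<close> independent vectors, and replacing one of them moves it by
  at most \<open>c = 4 \<beta>\<^sup>2 \<kappa>\<^sup>2 \<sigma> / (\<gamma>\<^sup>2 T)\<close>, where \<open>\<kappa> = \<kappa>(M)\<close> and \<open>\<sigma>\<close> is the largest singular value of
  \<open>Q + K\<^sup>T R K\<close>. McDiarmid's bounded differences inequality then gives the tail bound
  \<open>2 exp (- 2 \<epsilon>\<^sup>2 / (T c\<^sup>2))\<close>, and \<open>T c\<^sup>2\<close> is \<open>16 \<beta>\<^sup>4 \<kappa>\<^sup>4 \<sigma>\<^sup>2 / (\<gamma>\<^sup>4 T)\<close>, so the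
  constant 25 of the claim leaves room.

  McDiarmid's inequality (\<open>bounded_differences_inequality\<close>) rests on a bound for the
  moment generating function, \<open>E exp (l (f - E f)) \<le> exp (l\<^sup>2 \<Sum>c\<^sub>i\<^sup>2 / 8)\<close>, which is proved by integrating out
  one coordinate at a time: given the other coordinates, \<open>f\<close> ranges over an interval of length
  \<open>c\<^sub>i\<close>, so Hoeffding's lemma applies, and the average over the coordinate still has bounded
  differences \<open>c\<^sub>j\<close> in the others.

  The difference bound comes from the coordinates \<open>M\<^sup>-\<^sup>1 x\<close>, in which the closed loop acts as the
  contraction \<open>L\<close>. They show that the states have norm at most \<open>\<kappa> \<beta> / \<gamma>\<close> (\<open>norm_state_le\<close>), and that the
  deviations caused by a change of the noise, summed over time, are at most \<open>\<kappa> / \<gamma>\<close> times the total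
  change (\<open>sum_norm_state_diff_le\<close>), which is at most \<open>2 \<beta>\<close> when a single vector is replaced. The factor
  \<open>\<sigma>\<close> enters because the spectral norm is at most the largest singular value
  (\<open>spectral_norm_le_sigma_max\<close>). Since the noise is
  only almost surely bounded by \<open>\<beta>\<close>, it is clipped first, which changes the cost on a null set.
\<close>

section \<open>Functions with bounded differences\<close>

text \<open>
  Change the coordinates of \<open>y\<close> into those of \<open>x\<close> one after the other. In particular, a function with
  bounded differences on a nonempty product is bounded, hence integrable when it is measurable.
\<close>

lemma bounded_differences_diff_le_sum:
  fixes f :: "('i \<Rightarrow> 'a) \<Rightarrow> real"
  assumes "finite I"
    and bd: "\<And>i x y. i \<in> I \<Longrightarrow> x \<in> PiE I S \<Longrightarrow> y \<in> S i \<Longrightarrow> \<bar>f (x(i := y)) - f x\<bar> \<le> c i"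
    and x: "x \<in> PiE I S" and y: "y \<in> PiE I S"
  shows "\<bar>f x - f y\<bar> \<le> (\<Sum>i\<in>I. c i)"
proof -
  have mix: "override_on y x J \<in> PiE I S" if "J \<subseteq> I" for J
    using x y that by (auto simp: PiE_iff override_on_def extensional_def)
  have "\<bar>f (override_on y x J) - f y\<bar> \<le> (\<Sum>i\<in>J. c i)" if "J \<subseteq> I" for J
    using finite_subset[OF that \<open>finite I\<close>] that
  proof (induction J rule: finite_induct)
    case empty
    show ?case by simp
  next
    case (insert j J)
    have "\<bar>f ((override_on y x J)(j := x j)) - f (override_on y x J)\<bar> \<le> c j"
      using insert.prems x by (intro bd mix) auto
    moreover have "override_on y x (insert j J) = (override_on y x J)(j := x j)"
      by (auto simp: override_on_def)
    ultimately show ?case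
      using insert by (simp del: fun_upd_apply)
  qed
  moreover have "override_on y x I = x"
    using x y by (auto simp: override_on_def PiE_iff extensional_def fun_eq_iff)
  ultimately show ?thesis
    by fastforce
qed

text \<open>
  Hoeffding's lemma in terms of the oscillation of the variable: all values lie in an interval of
  length \<open>c\<close> that starts at their infimum.
\<close>

lemma nn_integral_exp_centered_le:
  assumes "prob_space N" and g [measurable]: "g \<in> borel_measurable N"
    and osc: "\<And>y z. y \<in> space N \<Longrightarrow> z \<in> space N \<Longrightarrow> g y - g z \<le> c"
    and "l > 0"
  shows "(\<integral>\<^sup>+y. ennreal (exp (l * (g y - (\<integral>y. g y \<partial>N)))) \<partial>N) \<le> ennreal (exp (l\<^sup>2 * c\<^sup>2 / 8))"
proof -
  interpret N: prob_space N by fact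
  obtain y0 where y0: "y0 \<in> space N"
    using N.not_empty by auto
  define a where "a = Inf (g ` space N)"
  have bdd: "bdd_below (g ` space N)"
    using osc[OF y0] by (intro bdd_belowI2[where m = "g y0 - c"]) (simp add: algebra_simps)
  have "g y - c \<le> a" if "y \<in> space N" for y
    unfolding a_def using N.not_empty osc[OF that] 
    by (intro cINF_greatest) (auto simp: algebra_simps)
  moreover have "a \<le> g y" if "y \<in> space N" for y
    unfolding a_def using bdd that by (intro cINF_lower) auto
  ultimately interpret interval_bounded_random_variable N g a "a + c"
    by unfold_locales (auto simp: algebra_simps intro!: AE_I2)
  show ?thesis
    using Hoeffdings_lemma_nn_integral[OF \<open>l > 0\<close>] by simp
qed

text \<open>
  Induction on the set of coordinates. For a new coordinate \<open>i\<close> write \<open>f - E f = (f - g) + (g - E g)\<close>,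
  where \<open>g\<close> averages \<open>f\<close> over coordinate \<open>i\<close>. With the other coordinates fixed, \<open>f - g\<close> is centered and
  oscillates by at most \<open>c i\<close>, which contributes the factor \<open>exp (l\<^sup>2 (c i)\<^sup>2 / 8)\<close> by Hoeffding's lemma;
  the remaining factor is the statement for \<open>g\<close>.
\<close>

lemma nn_integral_exp_bounded_differences_le:
  fixes f :: "('i \<Rightarrow> 'a) \<Rightarrow> real"
  assumes prob: "\<And>i. prob_space (M i)"
    and "finite I" and "f \<in> borel_measurable (PiM I M)"
    and "\<And>i x y. i \<in> I \<Longrightarrow> x \<in> space (PiM I M) \<Longrightarrow> y \<in> space (M i) \<Longrightarrow>
           \<bar>f (x(i := y)) - f x\<bar> \<le> c i"
    and "l > 0"
  shows "(\<integral>\<^sup>+x. ennreal (exp (l * (f x - (\<integral>x. f x \<partial>PiM I M)))) \<partial>PiM I M)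
           \<le> ennreal (exp (l\<^sup>2 * (\<Sum>i\<in>I. (c i)\<^sup>2) / 8))"
  using assms(2-4)
proof (induction I arbitrary: f rule: finite_induct)
  case empty
  interpret product_prob_space M "{}"
    using prob by (simp add: product_prob_space_def product_prob_space_axioms_def
      product_sigma_finite_def prob_space_imp_sigma_finite)
  show ?case
    by (simp add: PiM_empty nn_integral_count_space_finite lebesgue_integral_count_space_finite)
next
  case (insert i I)
  interpret product_prob_space M I
    using prob by (simp add: product_prob_space_def product_prob_space_axioms_def
      product_sigma_finite_def prob_space_imp_sigma_finite)
  interpret J: product_prob_space M "insert i I" ..
  note [measurable] = insert.prems(1)
  have space_upd: "x(i := y) \<in> space (PiM (insert i I) M)"
    if "x \<in> space (PiM I M)" "y \<in> space (M i)" for x y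
    using that by (auto simp: space_PiM PiE_iff extensional_def)
  have f_osc: "\<bar>f x - f y\<bar> \<le> (\<Sum>j\<in>insert i I. c j)"
    if "x \<in> space (PiM (insert i I) M)" "y \<in> space (PiM (insert i I) M)" for x y
    using that insert.prems(2) unfolding space_PiM
    by (intro bounded_differences_diff_le_sum[where S = "\<lambda>i. space (M i)"]) (use insert.hyps in auto)
  obtain x0 where x0: "x0 \<in> space (PiM (insert i I) M)"
    using J.P.not_empty by blast
  define C where "C = \<bar>f x0\<bar> + (\<Sum>j\<in>insert i I. c j)"
  have f_bdd: "\<bar>f x\<bar> \<le> C" if "x \<in> space (PiM (insert i I) M)" for x
    using f_osc[OF that x0] unfolding C_def by linarith
  define g where "g x = (\<integral>y. f (x(i := y)) \<partial>M i)" for x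
  have upd_meas: "(\<lambda>y. f (x(i := y))) \<in> borel_measurable (M i)"
    if "x \<in> space (PiM I M)" for x
    using that insert.hyps by measurable
  have upd_int: "integrable (M i) (\<lambda>y. f (x(i := y)))" if "x \<in> space (PiM I M)" for x
    using that by (intro M.integrable_const_bound[where B = C] AE_I2 upd_meas)
      (auto intro!: f_bdd space_upd)
  have g_meas [measurable]: "g \<in> borel_measurable (PiM I M)"
    unfolding g_def by measurable
  have g_bd: "\<bar>g (x(j := z)) - g x\<bar> \<le> c j"
    if "j \<in> I" "x \<in> space (PiM I M)" "z \<in> space (M j)" for j x z
  proof -
    have xz: "x(j := z) \<in> space (PiM I M)"
      using that by (auto simp: space_PiM PiE_iff extensional_def)
    have "j \<noteq> i" using that insert.hyps by auto
    have "g (x(j := z)) - g x = (\<integral>y. f (x(j := z, i := y)) - f (x(i := y)) \<partial>M i)"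
      unfolding g_def using upd_int[OF xz] upd_int[OF that(2)] by simp
    also have "\<bar>\<dots>\<bar> \<le> (\<integral>y. \<bar>f (x(j := z, i := y)) - f (x(i := y))\<bar> \<partial>M i)"
      by (rule integral_abs_bound)
    also have "\<dots> \<le> (\<integral>y. c j \<partial>M i)"
    proof (rule integral_mono)
      show "integrable (M i) (\<lambda>y. \<bar>f (x(j := z, i := y)) - f (x(i := y))\<bar>)"
        using upd_int[OF xz] upd_int[OF that(2)] by auto
      fix y assume y: "y \<in> space (M i)"
      have "x(j := z, i := y) = x(i := y, j := z)"
        using \<open>j \<noteq> i\<close> by auto
      then show "\<bar>f (x(j := z, i := y)) - f (x(i := y))\<bar> \<le> c j"
        using insert.prems(2)[of j "x(i := y)" z] space_upd[OF that(2) y] that by (simp del: fun_upd_apply)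
    qed auto
    finally show ?thesis by (simp add: M.prob_space)
  qed
  have f_int: "integrable (PiM (insert i I) M) f"
    by (intro J.P.integrable_const_bound[where B = C] AE_I2) (auto intro!: f_bdd)
  have mean: "(\<integral>x. f x \<partial>PiM (insert i I) M) = (\<integral>x. g x \<partial>PiM I M)" (is "_ = ?m")
    unfolding g_def using insert.hyps f_int by (intro product_integral_insert) auto
  have "(\<integral>\<^sup>+x. ennreal (exp (l * (f x - ?m))) \<partial>PiM (insert i I) M)
      = (\<integral>\<^sup>+x. (\<integral>\<^sup>+y. ennreal (exp (l * (f (x(i := y)) - ?m))) \<partial>M i) \<partial>PiM I M)"
    using insert.hyps by (intro product_nn_integral_insert) auto
  also have "\<dots> \<le> (\<integral>\<^sup>+x. ennreal (exp (l\<^sup>2 * (c i)\<^sup>2 / 8)) * ennreal (exp (l * (g x - ?m))) \<partial>PiM I M)"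
  proof (rule nn_integral_mono)
    fix x assume x: "x \<in> space (PiM I M)"
    note [measurable] = upd_meas[OF x]
    have "(\<integral>\<^sup>+y. ennreal (exp (l * (f (x(i := y)) - ?m))) \<partial>M i)
        = (\<integral>\<^sup>+y. ennreal (exp (l * (f (x(i := y)) - g x))) * ennreal (exp (l * (g x - ?m))) \<partial>M i)"
      by (simp add: algebra_simps flip: ennreal_mult exp_add)
    also have "\<dots> = (\<integral>\<^sup>+y. ennreal (exp (l * (f (x(i := y)) - g x))) \<partial>M i) * ennreal (exp (l * (g x - ?m)))"
      by (rule nn_integral_multc) measurable
    also have "\<dots> \<le> ennreal (exp (l\<^sup>2 * (c i)\<^sup>2 / 8)) * ennreal (exp (l * (g x - ?m)))"
    proof (rule mult_right_mono)
      have "f (x(i := y)) - f (x(i := z)) \<le> c i" if "y \<in> space (M i)" "z \<in> space (M i)" for y z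
        using insert.prems(2)[of i "x(i := z)" y] space_upd[OF x that(2)] that by (simp del: fun_upd_apply add: fun_upd_upd)
      then show "(\<integral>\<^sup>+y. ennreal (exp (l * (f (x(i := y)) - g x))) \<partial>M i)
          \<le> ennreal (exp (l\<^sup>2 * (c i)\<^sup>2 / 8))"
        unfolding g_def by (intro nn_integral_exp_centered_le prob \<open>l > 0\<close>) measurable
    qed simp
    finally show "(\<integral>\<^sup>+y. ennreal (exp (l * (f (x(i := y)) - ?m))) \<partial>M i)
        \<le> ennreal (exp (l\<^sup>2 * (c i)\<^sup>2 / 8)) * ennreal (exp (l * (g x - ?m)))" .
  qed
  also have "\<dots> = ennreal (exp (l\<^sup>2 * (c i)\<^sup>2 / 8)) * (\<integral>\<^sup>+x. ennreal (exp (l * (g x - ?m))) \<partial>PiM I M)"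
    by (rule nn_integral_cmult) measurable
  also have "\<dots> \<le> ennreal (exp (l\<^sup>2 * (c i)\<^sup>2 / 8)) * ennreal (exp (l\<^sup>2 * (\<Sum>j\<in>I. (c j)\<^sup>2) / 8))"
    by (intro mult_left_mono insert.IH g_meas g_bd) auto
  also have "\<dots> = ennreal (exp (l\<^sup>2 * (\<Sum>j\<in>insert i I. (c j)\<^sup>2) / 8))"
    using insert.hyps by (simp add: algebra_simps add_divide_distrib flip: ennreal_mult exp_add)
  finally show ?case
    unfolding mean .
qed

text \<open>
  Chernoff's method. If every \<open>c i\<close> is zero, the bound reads 1, because division by zero yields zero.
\<close>

lemma bounded_differences_upper_tail:
  fixes f :: "('i \<Rightarrow> 'a) \<Rightarrow> real"
  assumes prob: "\<And>i. prob_space (M i)"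
    and "finite I" and [measurable]: "f \<in> borel_measurable (PiM I M)"
    and bd: "\<And>i x y. i \<in> I \<Longrightarrow> x \<in> space (PiM I M) \<Longrightarrow> y \<in> space (M i) \<Longrightarrow>
           \<bar>f (x(i := y)) - f x\<bar> \<le> c i"
    and "\<epsilon> > 0"
  shows "measure (PiM I M) {x \<in> space (PiM I M). f x - (\<integral>x. f x \<partial>PiM I M) \<ge> \<epsilon>}
           \<le> exp (- (2 * \<epsilon>\<^sup>2 / (\<Sum>i\<in>I. (c i)\<^sup>2)))"
proof -
  interpret product_prob_space M I
    using prob by (simp add: product_prob_space_def product_prob_space_axioms_def
      product_sigma_finite_def prob_space_imp_sigma_finite)
  define d where "d = (\<Sum>i\<in>I. (c i)\<^sup>2)"
  let ?m = "\<integral>x. f x \<partial>PiM I M"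
  show ?thesis
  proof (cases "d = 0")
    case True
    then show ?thesis by (simp add: d_def)
  next
    case False
    then have "d > 0"
      by (simp add: d_def order_less_le sum_nonneg)
    \<comment> \<open>the minimiser of the exponent \<open>l\<^sup>2 d / 8 - l \<epsilon>\<close>\<close>
    define l where "l = 4 * \<epsilon> / d"
    have "l > 0" using \<open>d > 0\<close> \<open>\<epsilon> > 0\<close> by (simp add: l_def)
    have "ennreal (measure (PiM I M) {x \<in> space (PiM I M). f x - ?m \<ge> \<epsilon>})
        = emeasure (PiM I M) {x \<in> space (PiM I M). f x - ?m \<ge> \<epsilon>}"
      by (simp add: P.emeasure_eq_measure)
    also have "\<dots> \<le> ennreal (exp (- l * \<epsilon>)) *
        (\<integral>\<^sup>+x\<in>space (PiM I M). ennreal (exp (l * (f x - ?m))) \<partial>PiM I M)"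
      by (intro Chernoff_ineq_nn_integral_ge \<open>l > 0\<close>) auto
    also have "(\<integral>\<^sup>+x\<in>space (PiM I M). ennreal (exp (l * (f x - ?m))) \<partial>PiM I M)
        = (\<integral>\<^sup>+x. ennreal (exp (l * (f x - ?m))) \<partial>PiM I M)"
      by (intro nn_integral_cong) auto
    also have "ennreal (exp (- l * \<epsilon>)) * \<dots> \<le> ennreal (exp (- l * \<epsilon>)) * ennreal (exp (l\<^sup>2 * d / 8))"
      unfolding d_def using assms \<open>l > 0\<close>
      by (intro mult_left_mono nn_integral_exp_bounded_differences_le) auto
    also have "\<dots> = ennreal (exp (- (2 * \<epsilon>\<^sup>2 / d)))"
      using \<open>d > 0\<close> unfolding l_def
      by (simp add: field_simps power2_eq_square flip: ennreal_mult exp_add)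
    finally show ?thesis
      by (simp add: d_def)
  qed
qed

text \<open>
  McDiarmid's inequality. Independence says that the joint distribution of the variables is the
  product of their distributions, and the two tails are the upper tails of \<open>f\<close> and \<open>- f\<close>.
\<close>

theorem bounded_differences_inequality:
  fixes f :: "('i \<Rightarrow> 'a) \<Rightarrow> real"
  assumes "prob_space P" and indep: "prob_space.indep_vars P N X I"
    and "finite I" and f [measurable]: "f \<in> borel_measurable (PiM I N)"
    and bd: "\<And>i x y. i \<in> I \<Longrightarrow> x \<in> space (PiM I N) \<Longrightarrow> y \<in> space (N i) \<Longrightarrow>
           \<bar>f (x(i := y)) - f x\<bar> \<le> c i"
    and "\<epsilon> > 0"
  shows "measure P {\<omega> \<in> space P.
             \<bar>f (\<lambda>i\<in>I. X i \<omega>) - (\<integral>\<omega>'. f (\<lambda>i\<in>I. X i \<omega>') \<partial>P)\<bar> \<ge> \<epsilon>}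
           \<le> 2 * exp (- (2 * \<epsilon>\<^sup>2 / (\<Sum>i\<in>I. (c i)\<^sup>2)))"
proof (cases "I = {}")
  case True
  interpret P: prob_space P by fact
  show ?thesis
    using True order_trans[OF P.prob_le_1, of 2] by simp
next
  case False
  interpret P: prob_space P by fact
  have rv [measurable]: "X i \<in> measurable P (N i)" if "i \<in> I" for i
    using indep that by (auto simp: P.indep_vars_def)
  \<comment> \<open>The upper tail bound asks for a probability space at every index; a point mass serves outside
      \<open>I\<close>.\<close>
  define M where "M i = (if i \<in> I then distr P (N i) (X i) else return (count_space UNIV) undefined)" for i
  have prob: "prob_space (M i)" for i
    unfolding M_def using rv by (auto intro!: P.prob_space_distr prob_space_return)
  define X' where "X' \<omega> = (\<lambda>i\<in>I. X i \<omega>)" for \<omega>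
  have X' [measurable]: "X' \<in> measurable P (PiM I N)"
    unfolding X'_def by (rule measurable_restrict) (rule rv)
  have PiM_eq: "PiM I M = distr P (PiM I N) X'"
  proof -
    have "PiM I M = PiM I (\<lambda>i. distr P (N i) (X i))"
      by (rule PiM_cong) (auto simp: M_def)
    also have "\<dots> = distr P (PiM I N) X'"
      using P.indep_vars_iff_distr_eq_PiM'[OF False rv] indep by (simp add: X'_def [abs_def])
    finally show ?thesis .
  qed
  have tail: "P.prob {\<omega> \<in> space P. g (X' \<omega>) - (\<integral>\<omega>'. g (X' \<omega>') \<partial>P) \<ge> \<epsilon>}
      \<le> exp (- (2 * \<epsilon>\<^sup>2 / (\<Sum>i\<in>I. (c i)\<^sup>2)))"
    if [measurable]: "g \<in> borel_measurable (PiM I N)"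
      and g_bd: "\<And>i x y. i \<in> I \<Longrightarrow> x \<in> space (PiM I N) \<Longrightarrow> y \<in> space (N i) \<Longrightarrow>
           \<bar>g (x(i := y)) - g x\<bar> \<le> c i" for g
  proof -
    have m: "(\<integral>x. g x \<partial>PiM I M) = (\<integral>\<omega>. g (X' \<omega>) \<partial>P)"
      unfolding PiM_eq by (rule integral_distr) measurable
    have "measure (PiM I M) {x \<in> space (PiM I M). g x - (\<integral>x. g x \<partial>PiM I M) \<ge> \<epsilon>}
        \<le> exp (- (2 * \<epsilon>\<^sup>2 / (\<Sum>i\<in>I. (c i)\<^sup>2)))"
      using g_bd by (intro bounded_differences_upper_tail prob \<open>finite I\<close> \<open>\<epsilon> > 0\<close>)
        (auto simp: PiM_eq M_def)
    also have "measure (PiM I M) {x \<in> space (PiM I M). g x - (\<integral>x. g x \<partial>PiM I M) \<ge> \<epsilon>}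
        = P.prob {\<omega> \<in> space P. g (X' \<omega>) - (\<integral>\<omega>'. g (X' \<omega>') \<partial>P) \<ge> \<epsilon>}"
      unfolding m unfolding PiM_eq
      using measurable_space[OF X'] by (subst measure_distr) (auto intro!: arg_cong[where f = P.prob])
    finally show ?thesis .
  qed
  let ?E = "\<lambda>g. {\<omega> \<in> space P. g (X' \<omega>) - (\<integral>\<omega>'. g (X' \<omega>') \<partial>P) \<ge> \<epsilon>}"
  have "P.prob {\<omega> \<in> space P. \<bar>f (X' \<omega>) - (\<integral>\<omega>'. f (X' \<omega>') \<partial>P)\<bar> \<ge> \<epsilon>}
      \<le> P.prob (?E f \<union> ?E (\<lambda>x. - f x))"
    by (rule P.finite_measure_mono) (auto simp: abs_if split: if_splits)
  also have "\<dots> \<le> P.prob (?E f) + P.prob (?E (\<lambda>x. - f x))"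
    by (rule measure_Un_le) measurable
  also have "\<dots> \<le> 2 * exp (- (2 * \<epsilon>\<^sup>2 / (\<Sum>i\<in>I. (c i)\<^sup>2)))"
    using tail[OF f bd] tail[of "\<lambda>x. - f x"] bd by (force simp: abs_minus_commute)
  finally show ?thesis
    by (simp add: X'_def)
qed

section \<open>The spectral norm and the largest singular value\<close>

lemma inner_transpose_mult:
  fixes A :: "real ^ 'n ^ 'm"
  shows "x \<bullet> (transpose A *v y) = (A *v x) \<bullet> y"
  by (metis dot_lmul_matrix inner_commute vector_transpose_matrix transpose_transpose)

text \<open>
  Eigenvectors for distinct eigenvalues are orthogonal, so there are no more eigenvalues than the
  dimension. The finiteness is what gives meaning to the maximum in \<open>sigma_max\<close>.
\<close>

lemma finite_eigenvalues_symmetric: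
  fixes S :: "real ^ 'n ^ 'n"
  assumes sym: "transpose S = S"
  shows "finite (eigenvalues S)"
proof -
  have "\<forall>c\<in>eigenvalues S. \<exists>v. v \<noteq> 0 \<and> S *v v = c *s v"
    by (simp add: eigenvalues_def)
  then obtain v where v: "v c \<noteq> 0" "S *v v c = c *s v c" if "c \<in> eigenvalues S" for c
    by metis
  have orth: "v c \<bullet> v d = 0" if "c \<in> eigenvalues S" "d \<in> eigenvalues S" "c \<noteq> d" for c d
  proof -
    have "c * (v c \<bullet> v d) = (S *v v c) \<bullet> v d"
      using v(2)[OF that(1)] by (simp add: scalar_mult_eq_scaleR)
    also have "\<dots> = v c \<bullet> (S *v v d)"
      using inner_transpose_mult[of "v c" S "v d"] by (simp add: sym)
    also have "\<dots> = d * (v c \<bullet> v d)"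
      using v(2)[OF that(2)] by (simp add: scalar_mult_eq_scaleR)
    finally show ?thesis using \<open>c \<noteq> d\<close> by simp
  qed
  have "inj_on v (eigenvalues S)"
    using orth v(1) by (intro inj_onI) (metis inner_eq_zero_iff)
  moreover have "independent (v ` eigenvalues S)"
    using orth v(1) by (intro pairwise_orthogonal_independent)
      (auto simp: pairwise_def orthogonal_def)
  ultimately show ?thesis
    using finite_imageD independent_bound by blast
qed

lemma norm_mult_le_spectral_norm: "norm (A *v x) \<le> spectral_norm A * norm x"
  for A :: "real ^ 'n ^ 'm"
  unfolding spectral_norm_def by (rule onorm) simp

lemma spectral_norm_nonneg: "0 \<le> spectral_norm A" for A :: "real ^ 'n ^ 'm"
  unfolding spectral_norm_def by (rule onorm_pos_le) simp

text \<open>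
  By compactness \<open>norm (A *v x)\<close> attains its maximum \<open>s\<close> over the unit sphere at some \<open>v\<close>. The first-order
  condition at \<open>v\<close> says that \<open>v\<close> is an eigenvector of \<open>A\<^sup>T A\<close> for \<open>s\<^sup>2\<close>, so \<open>s\<close> is a singular value.
\<close>

lemma spectral_norm_le_sigma_max:
  fixes A :: "real ^ 'n ^ 'm"
  shows "spectral_norm A \<le> sigma_max A"
proof -
  have "\<exists>v\<in>sphere 0 1. \<forall>x\<in>sphere 0 1. norm (A *v x) \<le> norm (A *v (v :: real ^ 'n))"
    by (intro continuous_attains_sup continuous_on_norm linear_continuous_on) auto
  then obtain v :: "real ^ 'n" where v: "norm v = 1"
    and v_max: "\<And>x. norm x = 1 \<Longrightarrow> norm (A *v x) \<le> norm (A *v v)"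
    by auto
  define s where "s = norm (A *v v)"
  have max: "norm (A *v x) \<le> s * norm x" for x
  proof (cases "x = 0")
    case False
    then have "norm (A *v ((1 / norm x) *\<^sub>R x)) \<le> s"
      unfolding s_def by (intro v_max) simp
    with False show ?thesis
      by (simp add: matrix_vector_mult_scaleR field_simps)
  qed simp
  \<comment> \<open>\<open>- 2 u\<close> is the gradient of \<open>norm (A *v x)\<^sup>2 - s\<^sup>2 * norm x\<^sup>2\<close> at its maximiser \<open>v\<close>; the step
      \<open>- \<tau> u\<close> shows that it vanishes.\<close>
  define u where "u = s\<^sup>2 *\<^sub>R v - (transpose A ** A) *v v"
  define k where "k = s\<^sup>2 * (u \<bullet> u) - (A *v u) \<bullet> (A *v u)"
  have Avu: "(A *v v) \<bullet> (A *v u) = s\<^sup>2 * (v \<bullet> u) - u \<bullet> u"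
  proof -
    have "(A *v v) \<bullet> (A *v u) = u \<bullet> ((transpose A ** A) *v v)"
      by (metis inner_transpose_mult inner_commute matrix_vector_mul_assoc)
    also have "(transpose A ** A) *v v = s\<^sup>2 *\<^sub>R v - u"
      by (simp add: u_def)
    finally show ?thesis by (simp add: inner_diff_right inner_commute)
  qed
  have first_order: "2 * (u \<bullet> u) \<le> \<tau> * k" if "\<tau> > 0" for \<tau>
  proof -
    have "(norm (A *v (v - \<tau> *\<^sub>R u)))\<^sup>2 \<le> (s * norm (v - \<tau> *\<^sub>R u))\<^sup>2"
      using max by (intro power_mono) auto
    then have "(A *v v - \<tau> *\<^sub>R (A *v u)) \<bullet> (A *v v - \<tau> *\<^sub>R (A *v u))
        \<le> s\<^sup>2 * ((v - \<tau> *\<^sub>R u) \<bullet> (v - \<tau> *\<^sub>R u))"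
      by (simp add: power_mult_distrib power2_norm_eq_inner matrix_vector_mult_diff_distrib
        matrix_vector_mult_scaleR)
    moreover have "(A *v v) \<bullet> (A *v v) = s\<^sup>2" "v \<bullet> v = 1"
      using v by (simp_all add: s_def power2_norm_eq_inner norm_eq_1)
    moreover have "\<tau> * (2 * ((A *v v) \<bullet> (A *v u))) = \<tau> * (2 * (s\<^sup>2 * (v \<bullet> u) - u \<bullet> u))"
      unfolding Avu ..
    ultimately have "\<tau> * (2 * (u \<bullet> u)) \<le> \<tau> * (\<tau> * k)"
      by (simp add: k_def inner_diff_left inner_diff_right inner_commute algebra_simps)
    with that show ?thesis by simp
  qed
  have "u \<bullet> u \<le> 0"
  proof (rule ccontr)
    assume "\<not> u \<bullet> u \<le> 0"
    then have pos: "u \<bullet> u > 0" by linarith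
    define \<tau> where "\<tau> = (u \<bullet> u) / (\<bar>k\<bar> + 1)"
    have "\<tau> > 0" using pos unfolding \<tau>_def by (intro divide_pos_pos) auto
    have "\<tau> * k \<le> \<tau> * (\<bar>k\<bar> + 1)" using \<open>\<tau> > 0\<close> by (intro mult_left_mono) auto
    also have "\<dots> = u \<bullet> u" using abs_ge_zero[of k] by (simp add: \<tau>_def)
    finally show False using first_order[OF \<open>\<tau> > 0\<close>] pos by simp
  qed
  then have "u = 0" by (metis inner_ge_zero inner_eq_zero_iff order_antisym)
  then have "s\<^sup>2 \<in> eigenvalues (transpose A ** A)"
    using v unfolding eigenvalues_def u_def
    by (auto simp: scalar_mult_eq_scaleR intro!: exI[of _ v])
  then have "s \<in> singular_values A"
    by (simp add: singular_values_def s_def)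
  moreover have "finite (singular_values A)"
  proof (rule finite_imageD)
    have "finite (eigenvalues (transpose A ** A))"
      by (rule finite_eigenvalues_symmetric) (simp add: matrix_transpose_mul)
    then show "finite ((\<lambda>s. s\<^sup>2) ` singular_values A)"
      by (rule finite_subset[rotated]) (auto simp: singular_values_def)
    show "inj_on (\<lambda>s. s\<^sup>2) (singular_values A)"
      by (auto simp: inj_on_def singular_values_def)
  qed
  ultimately have "s \<le> sigma_max A"
    unfolding sigma_max_def by (rule Max_ge[rotated])
  moreover have "spectral_norm A \<le> s"
    unfolding spectral_norm_def using max by (intro onorm_bound) (auto simp: s_def)
  ultimately show ?thesis by linarith
qed

section \<open>Stability of the closed loop\<close>

lemma matrix_inv_inverse:
  assumes "invertible M"
  shows "M ** matrix_inv M = mat 1" "matrix_inv M ** M = mat 1"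
  using someI_ex[of "\<lambda>M'. M ** M' = mat 1 \<and> M' ** M = mat 1"] assms
  unfolding matrix_inv_def invertible_def by blast+

context
  fixes A :: "real ^ 'n ^ 'n" and B :: "real ^ 'm ^ 'n" and K :: "real ^ 'n ^ 'm"
    and M L :: "real ^ 'n ^ 'n" and \<gamma> :: real
  assumes M: "invertible M" and F: "A - B ** K = M ** L ** matrix_inv M"
    and L: "spectral_norm L = 1 - \<gamma>" and \<gamma>: "\<gamma> \<in> {0<..1}"
begin

text \<open>
  In the coordinates \<open>M\<^sup>-\<^sup>1 x\<close> the closed-loop matrix is \<open>L\<close>. Working there throughout costs a factor
  \<open>\<kappa>(M)\<close> once, when translating back, instead of at every step.
\<close>

lemma norm_closed_loop_le:
  "norm (matrix_inv M *v ((A - B ** K) *v x + y))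
     \<le> (1 - \<gamma>) * norm (matrix_inv M *v x) + spectral_norm (matrix_inv M) * norm y"
proof -
  have "matrix_inv M *v ((A - B ** K) *v x) = L *v (matrix_inv M *v x)"
    unfolding F by (simp add: matrix_vector_mul_assoc matrix_mul_assoc matrix_inv_inverse[OF M])
  then have "norm (matrix_inv M *v ((A - B ** K) *v x + y))
      \<le> norm (L *v (matrix_inv M *v x)) + norm (matrix_inv M *v y)"
    by (simp add: matrix_vector_right_distrib norm_triangle_ineq)
  also have "\<dots> \<le> (1 - \<gamma>) * norm (matrix_inv M *v x) + spectral_norm (matrix_inv M) * norm y"
    unfolding L [symmetric] by (intro add_mono norm_mult_le_spectral_norm)
  finally show ?thesis .
qed

lemma norm_le_norm_coordinates: "norm x \<le> spectral_norm M * norm (matrix_inv M *v x)"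
  using norm_mult_le_spectral_norm[of M "matrix_inv M *v x"]
  by (simp add: matrix_vector_mul_assoc matrix_inv_inverse[OF M])

text \<open>
  The bound \<open>p = \<parallel>M\<^sup>-\<^sup>1\<parallel> \<beta> / \<gamma>\<close> is the fixed point of \<open>p \<mapsto> (1 - \<gamma>) p + \<parallel>M\<^sup>-\<^sup>1\<parallel> \<beta>\<close>, hence an invariant of the
  recursion for the norm of the transformed state.
\<close>

lemma norm_state_le:
  assumes w: "\<And>s. s < t \<Longrightarrow> norm (w s) \<le> \<beta>" and "\<beta> \<ge> 0"
  shows "norm (state A B K w t) \<le> cond_number M * \<beta> / \<gamma>"
proof -
  let ?b = "spectral_norm (matrix_inv M)"
  have "norm (matrix_inv M *v state A B K w t) \<le> ?b * \<beta> / \<gamma>"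
    using w
  proof (induction t)
    case 0
    show ?case using \<gamma> \<open>\<beta> \<ge> 0\<close> by (simp add: spectral_norm_nonneg)
  next
    case (Suc t)
    have "norm (matrix_inv M *v state A B K w (Suc t))
        \<le> (1 - \<gamma>) * norm (matrix_inv M *v state A B K w t) + ?b * norm (w t)"
      by (simp add: norm_closed_loop_le)
    also have "\<dots> \<le> (1 - \<gamma>) * (?b * \<beta> / \<gamma>) + ?b * \<beta>"
      using Suc \<gamma> by (intro add_mono mult_left_mono) (auto simp: spectral_norm_nonneg)
    also have "\<dots> = ?b * \<beta> / \<gamma>"
      using \<gamma> by (simp add: field_simps)
    finally show ?case .
  qed
  then have "spectral_norm M * norm (matrix_inv M *v state A B K w t) \<le> spectral_norm M * (?b * \<beta> / \<gamma>)"
    by (intro mult_left_mono spectral_norm_nonneg)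
  with norm_le_norm_coordinates[of "state A B K w t"] show ?thesis
    by (simp add: cond_number_def mult.assoc)
qed

text \<open>
  Differences of states follow the same recursion, driven by the differences of the noise. Each step
  loses at least the fraction \<open>\<gamma>\<close> of the current deviation, so the losses \<open>\<gamma> \<Sum>e\<^sub>t\<close> together with the final deviation
  cannot exceed the total input; this balance stands in for summing the geometric series
  \<open>\<Sum>(1 - \<gamma>)\<^sup>k\<close>.
\<close>

lemma sum_norm_state_diff_le:
  "(\<Sum>t<T. norm (state A B K w t - state A B K w' t))
     \<le> cond_number M / \<gamma> * (\<Sum>t<T. norm (w t - w' t))"
proof -
  let ?b = "spectral_norm (matrix_inv M)"
  define e where "e t = norm (matrix_inv M *v (state A B K w t - state A B K w' t))" for t
  have step: "e (Suc t) \<le> (1 - \<gamma>) * e t + ?b * norm (w t - w' t)" for t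
    using norm_closed_loop_le[of "state A B K w t - state A B K w' t" "w t - w' t"]
    by (simp add: e_def matrix_vector_mult_diff_distrib algebra_simps)
  have "e T + \<gamma> * (\<Sum>t<T. e t) \<le> ?b * (\<Sum>t<T. norm (w t - w' t))"
  proof (induction T)
    case 0
    show ?case by (simp add: e_def)
  next
    case (Suc T)
    then show ?case using step[of T] by (simp add: algebra_simps)
  qed
  moreover have "e T \<ge> 0" by (simp add: e_def)
  ultimately have *: "\<gamma> * (\<Sum>t<T. e t) \<le> ?b * (\<Sum>t<T. norm (w t - w' t))" by linarith
  have "(\<Sum>t<T. norm (state A B K w t - state A B K w' t)) \<le> spectral_norm M * (\<Sum>t<T. e t)"
    unfolding e_def sum_distrib_left by (intro sum_mono norm_le_norm_coordinates)
  also have "\<dots> \<le> spectral_norm M * (?b * (\<Sum>t<T. norm (w t - w' t)) / \<gamma>)"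
    using * \<gamma> by (intro mult_left_mono spectral_norm_nonneg) (simp add: field_simps)
  finally show ?thesis by (simp add: cond_number_def mult_ac)
qed

text \<open>
  A quadratic form changes by at most \<open>\<parallel>S\<parallel> (\<parallel>x\<parallel> + \<parallel>x'\<parallel>) \<parallel>x - x'\<parallel>\<close>, and both states are bounded by
  \<open>\<kappa>(M) \<beta> / \<gamma>\<close>, so the change of the cost is controlled by the sum of the state deviations.
\<close>

lemma cost_diff_le:
  assumes "\<And>t. t < T \<Longrightarrow> norm (w t) \<le> \<beta>" "\<And>t. t < T \<Longrightarrow> norm (w' t) \<le> \<beta>" "\<beta> \<ge> 0"
  shows "\<bar>cost A B Q R T K w - cost A B Q R T K w'\<bar>
    \<le> 2 * \<beta> * (cond_number M)\<^sup>2 * spectral_norm (Q + transpose K ** R ** K) / (\<gamma>\<^sup>2 * real T)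
        * (\<Sum>t<T. norm (w t - w' t))"
proof -
  define S where "S = Q + transpose K ** R ** K"
  define x x' where "x = state A B K w" and "x' = state A B K w'"
  define X where "X = cond_number M * \<beta> / \<gamma>"
  have X: "X \<ge> 0" 
    using \<gamma> \<open>\<beta> \<ge> 0\<close> by (simp add: X_def cond_number_def spectral_norm_nonneg)
  have quad: "\<bar>x t \<bullet> (S *v x t) - x' t \<bullet> (S *v x' t)\<bar> \<le> 2 * X * spectral_norm S * norm (x t - x' t)"
    if "t < T" for t
  proof -
    have b: "norm (x t) \<le> X" "norm (x' t) \<le> X"
      unfolding x_def x'_def X_def using assms that by (auto intro!: norm_state_le)
    have "x t \<bullet> (S *v x t) - x' t \<bullet> (S *v x' t)
        = x t \<bullet> (S *v (x t - x' t)) + (x t - x' t) \<bullet> (S *v x' t)"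
      by (simp add: matrix_vector_mult_diff_distrib inner_diff_left inner_diff_right)
    also have "\<bar>\<dots>\<bar> \<le> norm (x t) * norm (S *v (x t - x' t)) + norm (x t - x' t) * norm (S *v x' t)"
      by (intro order_trans[OF abs_triangle_ineq] add_mono Cauchy_Schwarz_ineq2)
    also have "\<dots> \<le> X * (spectral_norm S * norm (x t - x' t)) + norm (x t - x' t) * (spectral_norm S * X)"
      using b X by (intro add_mono mult_mono norm_mult_le_spectral_norm
        order_trans[OF norm_mult_le_spectral_norm mult_left_mono]) (auto simp: spectral_norm_nonneg)
    finally show ?thesis by (simp add: algebra_simps)
  qed
  have "\<bar>cost A B Q R T K w - cost A B Q R T K w'\<bar>
      = \<bar>\<Sum>t<T. x t \<bullet> (S *v x t) - x' t \<bullet> (S *v x' t)\<bar> / real T"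
    by (simp add: cost_def x_def x'_def S_def sum_subtractf flip: diff_divide_distrib)
  also have "\<dots> \<le> (\<Sum>t<T. 2 * X * spectral_norm S * norm (x t - x' t)) / real T"
    using quad by (intro divide_right_mono order_trans[OF sum_abs] sum_mono) auto
  also have "\<dots> \<le> 2 * X * spectral_norm S * (cond_number M / \<gamma> * (\<Sum>t<T. norm (w t - w' t))) / real T"
    unfolding sum_distrib_left[symmetric] x_def x'_def using X
    by (intro divide_right_mono mult_left_mono sum_norm_state_diff_le) (auto simp: spectral_norm_nonneg)
  finally show ?thesis
    by (simp add: X_def S_def power2_eq_square mult_ac)
qed

end

section \<open>Concentration of the cost\<close>

lemma cost_cong:
  assumes "\<And>t. t < T \<Longrightarrow> w t = w' t"
  shows "cost A B Q R T K w = cost A B Q R T K w'"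
proof -
  have "state A B K w t = state A B K w' t" if "t \<le> T" for t
    using that by (induction t) (simp_all add: assms)
  then show ?thesis by (simp add: cost_def)
qed

lemma borel_measurable_cost:
  fixes A :: "real ^ 'n ^ 'n" and B :: "real ^ 'm ^ 'n"
  assumes w: "\<And>t. t < T \<Longrightarrow> w t \<in> borel_measurable N"
  shows "(\<lambda>\<omega>. cost A B Q R T K (\<lambda>t. w t \<omega>)) \<in> borel_measurable N"
proof -
  have mult [measurable]: "(\<lambda>\<omega>. C *v x \<omega>) \<in> borel_measurable N"
    if "x \<in> borel_measurable N" for C :: "real ^ 'n ^ 'n" and x
    by (rule measurable_compose[OF that])
      (intro borel_measurable_continuous_onI linear_continuous_on matrix_vector_mul_bounded_linear)
  have [measurable]: "(\<lambda>\<omega>. state A B K (\<lambda>t. w t \<omega>) t) \<in> borel_measurable N" if "t \<le> T" for t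
    using that
  proof (induction t)
    case (Suc t)
    then have [measurable]: "w t \<in> borel_measurable N"
        "(\<lambda>\<omega>. state A B K (\<lambda>t. w t \<omega>) t) \<in> borel_measurable N"
      using w by auto
    show ?case by simp
  qed simp
  show ?thesis
    unfolding cost_def by (intro borel_measurable_times borel_measurable_sum borel_measurable_inner) auto
qed

theorem lemma5:
  fixes A :: "real ^ 'n ^ 'n" and B :: "real ^ 'm ^ 'n"
    and Q :: "real ^ 'n ^ 'n" and R :: "real ^ 'm ^ 'm"
    and K :: "real ^ 'n ^ 'm" and M L :: "real ^ 'n ^ 'n"
    and \<beta> \<gamma> \<epsilon> :: real and T :: nat
    and P :: "'w measure" and D :: "(real ^ 'n) measure"
    and w :: "nat \<Rightarrow> 'w \<Rightarrow> real ^ 'n"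
  assumes "stabilizable A B"
    and "sym_pos_semidef Q" and "sym_pos_def R"
    and "T \<ge> 1" and "\<beta> > 0"
    and "prob_space P"
    and "prob_space.indep_vars P (\<lambda>_. borel) w {..<T}"
    and "\<And>t. t < T \<Longrightarrow> distr P borel (w t) = D"
    and "(\<integral>x. x \<partial>D) = 0"
    and "\<And>t. t < T \<Longrightarrow> AE \<omega> in P. norm (w t \<omega>) \<le> \<beta>"
    and "stable_matrix (A - B ** K)"
    and "invertible M" and "A - B ** K = M ** L ** matrix_inv M"
    and "spectral_norm L = 1 - \<gamma>" and "\<gamma> \<in> {0<..1}"
    and "\<epsilon> > 0"
  shows "measure P {\<omega> \<in> space P.
             \<bar>cost A B Q R T K (\<lambda>t. w t \<omega>)
               - (\<integral>\<omega>'. cost A B Q R T K (\<lambda>t. w t \<omega>') \<partial>P)\<bar> \<ge> \<epsilon>}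
         \<le> 2 * exp (- (2 * \<epsilon>\<^sup>2 * \<gamma> ^ 4 * real T
                / (25 * \<beta> ^ 4 * cond_number M ^ 4
                     * (sigma_max (Q + transpose K ** R ** K))\<^sup>2)))"
proof -
  interpret P: prob_space P by fact
  define S where "S = Q + transpose K ** R ** K"
  define \<kappa> where "\<kappa> = cond_number M"
  define e where
    "e = 2 * \<epsilon>\<^sup>2 * \<gamma> ^ 4 * real T / (\<beta> ^ 4 * \<kappa> ^ 4 * (sigma_max S)\<^sup>2)"
  let ?c = "4 * \<beta>\<^sup>2 * \<kappa>\<^sup>2 * sigma_max S / (\<gamma>\<^sup>2 * real T)"
  \<comment> \<open>Bounded differences are needed for all arguments, but the noise is bounded only almost surely.\<close>
  define clip :: "real ^ 'n \<Rightarrow> real ^ 'n" where "clip y = (if norm y \<le> \<beta> then y else 0)" for y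
  have clip_le: "norm (clip y) \<le> \<beta>" for y
    using \<open>\<beta> > 0\<close> by (simp add: clip_def)
  have [measurable]: "clip \<in> borel_measurable borel"
    unfolding clip_def by measurable
  have w [measurable]: "w t \<in> borel_measurable P" if "t < T" for t
    using assms(7) that by (auto simp: P.indep_vars_def)
  define f where "f x = cost A B Q R T K (\<lambda>t. clip (x t))" for x
  have f_meas [measurable]: "f \<in> borel_measurable (PiM {..<T} (\<lambda>_. borel))"
    unfolding f_def by (intro borel_measurable_cost) measurable

  have f_bd: "\<bar>f (x(i := y)) - f x\<bar> \<le> ?c" if "i \<in> {..<T}" for i x y
  proof -
    have "(\<Sum>t<T. norm (clip ((x(i := y)) t) - clip (x t)))
        = (\<Sum>t<T. if t = i then norm (clip y - clip (x i)) else 0)"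
      by (intro sum.cong) auto
    also have "\<dots> = norm (clip y - clip (x i))"
      using that by (subst sum.delta) auto
    also have "\<dots> \<le> 2 * \<beta>"
      using norm_triangle_ineq4[of "clip y" "clip (x i)"] clip_le[of y] clip_le[of "x i"] by linarith
    finally have change: "(\<Sum>t<T. norm (clip ((x(i := y)) t) - clip (x t))) \<le> 2 * \<beta>" .
    have "\<bar>f (x(i := y)) - f x\<bar> \<le> 2 * \<beta> * \<kappa>\<^sup>2 * spectral_norm S / (\<gamma>\<^sup>2 * real T)
        * (\<Sum>t<T. norm (clip ((x(i := y)) t) - clip (x t)))"
      unfolding f_def \<kappa>_def S_def using \<open>\<beta> > 0\<close> clip_le
      by (intro cost_diff_le[OF assms(12-15)]) auto
    also have "\<dots> \<le> 2 * \<beta> * \<kappa>\<^sup>2 * sigma_max S / (\<gamma>\<^sup>2 * real T) * (2 * \<beta>)"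
      using \<open>\<beta> > 0\<close> change spectral_norm_le_sigma_max[of S] spectral_norm_nonneg[of S]
      by (intro mult_mono divide_right_mono mult_left_mono) (auto intro!: sum_nonneg)
    finally show ?thesis
      by (simp add: power2_eq_square mult_ac)
  qed

  have cost_eq: "AE \<omega> in P. cost A B Q R T K (\<lambda>t. w t \<omega>) = f (\<lambda>t\<in>{..<T}. w t \<omega>)"
  proof -
    have "AE \<omega> in P. \<forall>t\<in>{..<T}. norm (w t \<omega>) \<le> \<beta>"
      using assms(10) by (subst AE_finite_all) auto
    then show ?thesis
      unfolding f_def by eventually_elim (auto intro!: cost_cong simp: clip_def)
  qed
  have restr [measurable]: "(\<lambda>\<omega>. \<lambda>t\<in>{..<T}. w t \<omega>) \<in> measurable P (PiM {..<T} (\<lambda>_. borel))"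
    by (rule measurable_restrict) simp
  have f_w [measurable]: "(\<lambda>\<omega>. f (\<lambda>t\<in>{..<T}. w t \<omega>)) \<in> borel_measurable P"
    by (rule measurable_compose[OF restr f_meas])
  have mean_eq: "(\<integral>\<omega>. cost A B Q R T K (\<lambda>t. w t \<omega>) \<partial>P) = (\<integral>\<omega>. f (\<lambda>t\<in>{..<T}. w t \<omega>) \<partial>P)"
    by (intro integral_cong_AE cost_eq borel_measurable_cost f_w w)

  have "P.prob {\<omega> \<in> space P. \<bar>cost A B Q R T K (\<lambda>t. w t \<omega>)
          - (\<integral>\<omega>'. cost A B Q R T K (\<lambda>t. w t \<omega>') \<partial>P)\<bar> \<ge> \<epsilon>}
      \<le> P.prob {\<omega> \<in> space P. \<bar>f (\<lambda>t\<in>{..<T}. w t \<omega>)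
          - (\<integral>\<omega>'. f (\<lambda>t\<in>{..<T}. w t \<omega>') \<partial>P)\<bar> \<ge> \<epsilon>}"
    unfolding mean_eq
  proof (rule P.finite_measure_mono_AE)
    show "AE \<omega> in P. \<omega> \<in> {\<omega> \<in> space P. \<bar>cost A B Q R T K (\<lambda>t. w t \<omega>)
          - (\<integral>\<omega>'. f (\<lambda>t\<in>{..<T}. w t \<omega>') \<partial>P)\<bar> \<ge> \<epsilon>}
      \<longrightarrow> \<omega> \<in> {\<omega> \<in> space P. \<bar>f (\<lambda>t\<in>{..<T}. w t \<omega>)
          - (\<integral>\<omega>'. f (\<lambda>t\<in>{..<T}. w t \<omega>') \<partial>P)\<bar> \<ge> \<epsilon>}"
      using cost_eq by eventually_elim simp
  qed measurable
  also have "\<dots> \<le> 2 * exp (- (2 * \<epsilon>\<^sup>2 / (\<Sum>t<T. ?c\<^sup>2)))"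
    by (rule bounded_differences_inequality[OF assms(6,7) finite_lessThan f_meas f_bd assms(16)])
  also have "(\<Sum>t<T. ?c\<^sup>2) = 16 * \<beta> ^ 4 * \<kappa> ^ 4 * (sigma_max S)\<^sup>2 / (\<gamma> ^ 4 * real T)"
    using \<open>T \<ge> 1\<close> by (simp add: power_divide power_mult_distrib power2_eq_square power4_eq_xxxx mult_ac)
  also have "2 * \<epsilon>\<^sup>2 / \<dots> = e / 16"
    by (simp add: e_def)
  also have "2 * exp (- (e / 16)) \<le> 2 * exp (- (e / 25))"
  proof -
    have "e \<ge> 0" by (simp add: e_def)
    then show ?thesis by simp
  qed
  finally show ?thesis
    by (simp add: e_def S_def \<kappa>_def mult_ac)
qed

end
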